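(* Let $G$ and $H$ be two non-trivial connected graphs of order $n_1$ and $n_2$, having $t_1$ and $t_2$ true twin equivalence classes, respectively. Then $\dim_l(G\boxtimes H)\ge n_1n_2-t_1t_2$.
   Context: Two vertices $u,v$ are true twins if $N_G[u]=N_G[v]$ (closed neighborhoods); the true twin equivalence classes are the classes of the relation $N_G[x]=N_G[y]$. A set $S$ is a local metric generator for a connected graph $G$ if for every two adjacent vertices $x,y$ there is $s\in S$ with $d_G(s,x)\ne d_G(s,y)$; $\dim_l(G)$ is the minimum cardinality of a local metric generator. The strong product $G\boxtimes H$ has vertex set $V(G)\times V(H)$, with $(a,b)\sim(c,d)$ iff ($a=c$ and $b\sim d$) or ($b=d$ and $a\sim c$) or ($a\sim c$ and $b\sim d$). *)

theory Defs
  imports "Graph_Theory.Graph_Theory"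
begin

text \<open>
  A finite simple graph is a symmetric, loop-free digraph without parallel arcs
  (locale \<open>pair_graph\<close>); an undirected edge is represented by its two opposite arcs.
\<close>

definition closed_nbhd :: "'a pair_pre_digraph \<Rightarrow> 'a \<Rightarrow> 'a set" where
  "closed_nbhd G x = insert x {y. x \<rightarrow>\<^bsub>with_proj G\<^esub> y}"

definition true_twin_rel :: "'a pair_pre_digraph \<Rightarrow> 'a rel" where
  "true_twin_rel G =
    {(x, y). x \<in> pverts G \<and> y \<in> pverts G \<and> closed_nbhd G x = closed_nbhd G y}"

definition true_twin_classes :: "'a pair_pre_digraph \<Rightarrow> 'a set set" where
  "true_twin_classes G = pverts G // true_twin_rel G"

lemma equiv_true_twin_rel: "equiv (pverts G) (true_twin_rel G)"
  by (auto simp: true_twin_rel_def intro!: equivI refl_onI symI transI)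

text \<open>Unit arc weights: the minimum number of edges of a walk from \<open>u\<close> to \<open>v\<close>.\<close>
definition graph_dist :: "'a pair_pre_digraph \<Rightarrow> 'a \<Rightarrow> 'a \<Rightarrow> ereal" where
  "graph_dist G u v = wf_digraph.\<mu> (with_proj G) (\<lambda>_. 1) u v"

definition local_metric_generator :: "'a pair_pre_digraph \<Rightarrow> 'a set \<Rightarrow> bool" where
  "local_metric_generator G S \<longleftrightarrow> S \<subseteq> pverts G \<and>
    (\<forall>x y. x \<rightarrow>\<^bsub>with_proj G\<^esub> y \<longrightarrow> (\<exists>s\<in>S. graph_dist G s x \<noteq> graph_dist G s y))"

lemma local_metric_generator_pverts:
  assumes "pair_graph G"
  shows "local_metric_generator G (pverts G)"
proof -
  interpret pair_graph G by fact
  have nonneg: "0 \<le> awalk_cost (\<lambda>_. 1) p" for p :: "('a \<times> 'a) awalk"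
    by (induction p) auto
  have "\<exists>s\<in>pverts G. graph_dist G s x \<noteq> graph_dist G s y" if xy: "(x, y) \<in> parcs G" for x y
  proof (rule bexI)
    have x: "x \<in> pverts G" and ne: "x \<noteq> y"
      using xy by (auto dest: in_arcsD1 no_loops')
    have "graph_dist G x x \<le> 0"
      using min_cost_le_walk_cost[of x "[]" x "\<lambda>_. 1"] x
      by (simp add: graph_dist_def awalk_Nil_iff zero_ereal_def)
    moreover have "1 \<le> graph_dist G x y"
      unfolding graph_dist_def \<mu>_def
    proof (rule INF_greatest)
      fix p assume "p \<in> {p. awalk x p y}"
      then obtain e q where "p = e # q"
        using ne by (cases p) (auto simp: awalk_Nil_iff)
      then show "1 \<le> ereal (awalk_cost (\<lambda>_. 1) p)"
        using nonneg[of q] by (simp add: one_ereal_def)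
    qed
    ultimately show "graph_dist G x x \<noteq> graph_dist G x y"
      by (auto dest: order_trans)
  qed (use xy in \<open>auto dest: in_arcsD1\<close>)
  then show ?thesis by (auto simp: local_metric_generator_def)
qed

definition local_metric_dim :: "'a pair_pre_digraph \<Rightarrow> nat" where
  "local_metric_dim G = (LEAST k. \<exists>S. local_metric_generator G S \<and> card S = k)"

definition strong_product ::
    "'a pair_pre_digraph \<Rightarrow> 'b pair_pre_digraph \<Rightarrow> ('a \<times> 'b) pair_pre_digraph"
    (infixl \<open>\<boxtimes>\<close> 70) where
  "G \<boxtimes> H = \<lparr> pverts = pverts G \<times> pverts H,
    parcs = {((a, b), (c, d)).
        (a \<in> pverts G \<and> a = c \<and> b \<rightarrow>\<^bsub>with_proj H\<^esub> d)
      \<or> (b \<in> pverts H \<and> b = d \<and> a \<rightarrow>\<^bsub>with_proj G\<^esub> c)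
      \<or> (a \<rightarrow>\<^bsub>with_proj G\<^esub> c \<and> b \<rightarrow>\<^bsub>with_proj H\<^esub> d)} \<rparr>"

lemma pair_graph_arc_sym:
  assumes "pair_graph G" "(u, v) \<in> parcs G"
  shows "(v, u) \<in> parcs G"
proof -
  interpret pair_graph G by fact
  show ?thesis using arcs_ends_symmetric[OF pair_sym_arcs, of u v] assms(2) by simp
qed

lemma pair_graph_strong_product:
  assumes "pair_graph G" "pair_graph H"
  shows "pair_graph (G \<boxtimes> H)"
proof -
  interpret G: pair_graph G by fact
  interpret H: pair_graph H by fact
  have sub: "parcs (G \<boxtimes> H) \<subseteq> (pverts G \<times> pverts H) \<times> (pverts G \<times> pverts H)"
    by (auto simp: strong_product_def dest: G.in_arcsD1 G.in_arcsD2 H.in_arcsD1 H.in_arcsD2)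
  have verts: "pverts (G \<boxtimes> H) = pverts G \<times> pverts H" by (simp add: strong_product_def)
  show ?thesis
  proof
    fix e assume e: "e \<in> parcs (G \<boxtimes> H)"
    then show "fst e \<in> pverts (G \<boxtimes> H)" "snd e \<in> pverts (G \<boxtimes> H)"
      using sub unfolding verts by (metis mem_Times_iff subsetD)+
    show "fst e \<noteq> snd e"
      using e by (auto simp: strong_product_def dest: G.no_loops' H.no_loops')
  next
    show "finite (pverts (G \<boxtimes> H))" by (simp add: verts)
    show "finite (parcs (G \<boxtimes> H))" by (rule finite_subset[OF sub]) simp
    show "symmetric (with_proj (G \<boxtimes> H))"
      unfolding symmetric_def with_proj_simps
      by (rule symI) (auto simp: strong_product_def
          dest: pair_graph_arc_sym[OF assms(1)] pair_graph_arc_sym[OF assms(2)])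
  qed
qed

end

theory Submission
  imports Defs
begin

text \<open>
  If \<open>x\<close> and \<open>y\<close> are true twins, a walk from \<open>s \<noteq> x\<close> to \<open>x\<close> can be redirected to \<open>y\<close> at its
  last arc, so twins are equidistant from every other vertex. Distinct true twins are adjacent,
  hence a local metric generator misses at most one vertex of each twin class. In
  \<open>G \<boxtimes> H\<close>, pairs of true twins are true twins, so the vertices missed by a generator inject into
  the pairs of twin classes of the factors.
\<close>

lemma graph_dist_true_twin_le:
  assumes "pair_graph G" and "closed_nbhd G x = closed_nbhd G y" and "s \<noteq> x"
  shows "graph_dist G s y \<le> graph_dist G s x"
proof -
  interpret pair_graph G by fact
  show ?thesis
    unfolding graph_dist_def \<mu>_def[of _ s x]
  proof (rule INF_greatest)
    \<comment> \<open>As \<open>s \<noteq> x\<close>, the walk is not empty and has a last arc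
      \<open>(u, x)\<close>. Then \<open>u\<close> lies in the common closed neighbourhood, so it is
      \<open>y\<close> itself or a neighbour of \<open>y\<close>.\<close>
    fix p assume "p \<in> {p. awalk s p x}"
    with \<open>s \<noteq> x\<close> obtain q u where p: "p = q @ [(u, x)]" and q: "awalk s q u"
      and ux: "(u, x) \<in> parcs G"
      by (cases p rule: rev_cases) (auto simp: awalk_Nil_iff awalk_Cons_iff)
    have "u \<in> closed_nbhd G y"
      using pair_graph_arc_sym[OF assms(1) ux] assms(2) by (auto simp: closed_nbhd_def)
    then consider "u = y" | "(u, y) \<in> parcs G"
      using pair_graph_arc_sym[OF assms(1)] by (auto simp: closed_nbhd_def)
    then show "\<mu> (\<lambda>_. 1) s y \<le> ereal (awalk_cost (\<lambda>_. 1) p)"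
    proof cases
      case 1
      \<comment> \<open>Here \<open>q\<close> already ends at \<open>y\<close>, and dropping the
        last arc only lowers the cost.\<close>
      then have "\<mu> (\<lambda>_. 1) s y \<le> awalk_cost (\<lambda>_. 1) q"
        using q min_cost_le_walk_cost by blast
      also have "\<dots> \<le> awalk_cost (\<lambda>_. 1) p"
        by (simp add: p)
      finally show ?thesis .
    next
      case 2
      \<comment> \<open>Replacing the last arc by \<open>(u, y)\<close> keeps the cost.\<close>
      then have "awalk s (q @ [(u, y)]) y"
        using q by (auto simp: awalk_Cons_iff awalk_Nil_iff dest: in_arcsD2)
      from min_cost_le_walk_cost[OF this] show ?thesis
        by (simp add: p)
    qed
  qed
qed

lemma true_twins_meet_local_metric_generator:
  assumes "pair_graph G" and "local_metric_generator G S"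
    and twins: "closed_nbhd G x = closed_nbhd G y" and "x \<noteq> y"
  shows "x \<in> S \<or> y \<in> S"
proof (rule ccontr)
  assume "\<not> (x \<in> S \<or> y \<in> S)"
  \<comment> \<open>Each \<open>s\<close> in \<open>S\<close> differs from both twins, so the
    one-sided bound applies in both directions.\<close>
  then have "graph_dist G s x = graph_dist G s y" if "s \<in> S" for s
    using that twins
    by (metis antisym graph_dist_true_twin_le[OF assms(1)])
  \<comment> \<open>\<open>y\<close> lies in its own closed neighbourhood, hence in that of
    \<open>x\<close>.\<close>
  moreover have "x \<rightarrow>\<^bsub>with_proj G\<^esub> y"
    using twins \<open>x \<noteq> y\<close> by (auto simp: closed_nbhd_def)
  ultimately show False
    using assms(2) unfolding local_metric_generator_def by blast
qed

text \<open>In each coordinate a member is either equal or adjacent to the centre. Of the four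
  combinations, equal-equal is the centre and the other three are the three kinds of arcs.\<close>

lemma closed_nbhd_strong_product:
  assumes "a \<in> pverts G" and "b \<in> pverts H"
  shows "closed_nbhd (G \<boxtimes> H) (a, b) = closed_nbhd G a \<times> closed_nbhd H b"
  using assms by (auto simp: closed_nbhd_def strong_product_def)

lemma card_Diff_local_metric_generator_strong_product_le:
  assumes "pair_graph G" and "pair_graph H" and "local_metric_generator (G \<boxtimes> H) S"
  shows "card (pverts (G \<boxtimes> H) - S) \<le> card (true_twin_classes G) * card (true_twin_classes H)"
proof -
  interpret G: pair_graph G by fact
  interpret H: pair_graph H by fact
  \<comment> \<open>Two missed vertices with the same image would be twins in the product, and
    \<open>S\<close> contains one of any two distinct twins.\<close>
  let ?cls = "\<lambda>(a, b). (true_twin_rel G `` {a}, true_twin_rel H `` {b})"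
  have "inj_on ?cls (pverts (G \<boxtimes> H) - S)"
  proof (rule inj_onI, rule ccontr)
    fix p q
    assume p: "p \<in> pverts (G \<boxtimes> H) - S" and q: "q \<in> pverts (G \<boxtimes> H) - S"
      and eq: "?cls p = ?cls q" and "p \<noteq> q"
    obtain a b c d where pq: "p = (a, b)" "q = (c, d)"
      by fastforce
    have V: "a \<in> pverts G" "b \<in> pverts H" "c \<in> pverts G" "d \<in> pverts H"
      using p q by (auto simp: pq strong_product_def)
    have "(a, c) \<in> true_twin_rel G" "(b, d) \<in> true_twin_rel H"
      using eq V by (auto simp: pq eq_equiv_class_iff[OF equiv_true_twin_rel])
    then have "closed_nbhd (G \<boxtimes> H) p = closed_nbhd (G \<boxtimes> H) q"
      using V by (simp add: pq closed_nbhd_strong_product true_twin_rel_def)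
    from true_twins_meet_local_metric_generator
      [OF pair_graph_strong_product[OF assms(1,2)] assms(3) this \<open>p \<noteq> q\<close>] p q
    show False by auto
  qed
  moreover have "?cls ` (pverts (G \<boxtimes> H) - S) \<subseteq> true_twin_classes G \<times> true_twin_classes H"
    by (auto simp: strong_product_def true_twin_classes_def intro!: quotientI)
  moreover have "finite (true_twin_classes G \<times> true_twin_classes H)"
    by (auto simp: true_twin_classes_def quotient_def)
  ultimately have "card (pverts (G \<boxtimes> H) - S) \<le> card (true_twin_classes G \<times> true_twin_classes H)"
    by (rule card_inj_on_le)
  then show ?thesis by (simp add: card_cartesian_product)
qed

text \<open>The full vertex set is a generator, so the \<open>LEAST\<close> ranges over a nonempty
  set of cardinalities.\<close>

lemma local_metric_dim_attained:
  assumes "pair_graph G"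
  obtains S where "local_metric_generator G S" and "card S = local_metric_dim G"
  using LeastI[of "\<lambda>k. \<exists>S. local_metric_generator G S \<and> card S = k"]
    local_metric_generator_pverts[OF assms]
  unfolding local_metric_dim_def by blast

theorem theorem10:
  fixes G :: "'a pair_pre_digraph" and H :: "'b pair_pre_digraph"
    and n\<^sub>1 n\<^sub>2 t\<^sub>1 t\<^sub>2 :: nat
  assumes "pair_graph G" and "Digraph_Component.connected (with_proj G)"
    and "card (pverts G) = n\<^sub>1" and "n\<^sub>1 \<ge> 2"
    and "pair_graph H" and "Digraph_Component.connected (with_proj H)"
    and "card (pverts H) = n\<^sub>2" and "n\<^sub>2 \<ge> 2"
    and "card (true_twin_classes G) = t\<^sub>1" and "card (true_twin_classes H) = t\<^sub>2"
  shows "int (local_metric_dim (G \<boxtimes> H)) \<ge> int n\<^sub>1 * int n\<^sub>2 - int t\<^sub>1 * int t\<^sub>2"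
proof -
  obtain S where S: "local_metric_generator (G \<boxtimes> H) S"
    and card_S: "card S = local_metric_dim (G \<boxtimes> H)"
    using local_metric_dim_attained[OF pair_graph_strong_product[OF assms(1,5)]] .
  interpret GH: pair_graph "G \<boxtimes> H"
    by (rule pair_graph_strong_product[OF assms(1,5)])
  \<comment> \<open>Finiteness matters because \<open>card\<close> of an infinite set is 0, which
    would spoil the count below.\<close>
  have finite_S: "finite S"
    using S GH.pair_finite_verts by (auto simp: local_metric_generator_def intro: finite_subset)
  have "n\<^sub>1 * n\<^sub>2 = card (pverts (G \<boxtimes> H))"
    using assms(3,7) by (simp add: strong_product_def card_cartesian_product)
  also have "\<dots> \<le> card S + card (pverts (G \<boxtimes> H) - S)"
    using diff_card_le_card_Diff[of S "pverts (G \<boxtimes> H)"] finite_S by simp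
  also have "\<dots> \<le> local_metric_dim (G \<boxtimes> H) + t\<^sub>1 * t\<^sub>2"
    using card_Diff_local_metric_generator_strong_product_le[OF assms(1,5) S] card_S assms(9,10)
    by simp
  finally show ?thesis
    by (metis diff_le_eq of_nat_add of_nat_le_iff of_nat_mult)
qed

end
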